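(* Let $G$ be a connected graph and let $X\subseteq V(G)$ with $|X|\ge 2$. Then $X$ is an outer general position set of $G$ if and only if each pair of (distinct) vertices from $X$ is mutually maximally distant in $G$. Moreover, $\mathrm{gp}_{\mathrm o}(G)=\omega(G_{\mathrm{SR}})$, where $G_{\mathrm{SR}}$ is the strong resolving graph of $G$ and $\omega$ denotes the clique number.
   Context: All graphs are finite, simple and nonempty. $d_G$ is the shortest-path distance and $N_G(u)$ is the open neighbourhood of $u$. For $X\subseteq V(G)$, vertices $u,v\in V(G)$ are $X$-positionable if for every shortest $u,v$-path $P$ in $G$ we have $V(P)\cap X\subseteq\{u,v\}$. A set $X\subseteq V(G)$ is an outer general position set if every $u,v\in X$ are $X$-positionable and every $u\in X$, $v\in V(G)\setminus X$ are $X$-positionable. The outer general position number $\mathrm{gp}_{\mathrm o}(G)$ is the cardinality of a largest outer general position set of $G$. A vertex $u$ is maximally distant from $v\in V(G)$ if $d_G(v,w)\le d_G(u,v)$ for every $w\in N_G(u)$; distinct vertices $u,v$ are mutually maximally distant if $u$ is maximally distant from $v$ and $v$ is maximally distant from $u$. The strong resolving graph $G_{\mathrm{SR}}$ has vertex set $V(G)$ (and need not be connected), two distinct vertices being adjacent in $G_{\mathrm{SR}}$ if and only if they are mutually maximally distant in $G$. *)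

theory Defs
  imports "Graph_Theory.Graph_Theory"
begin

text \<open>
  A finite simple graph is a \<^locale>\<open>graph\<close>: a finite symmetric digraph without loops and
  parallel arcs, where an undirected edge is a pair of opposite arcs. The null graph is allowed by
  \<^locale>\<open>graph\<close> but excluded by \<^const>\<open>connected\<close>.
\<close>

definition nbhd :: "('a, 'b) pre_digraph \<Rightarrow> 'a \<Rightarrow> 'a set" where
  "nbhd G u = {w. u \<rightarrow>\<^bsub>G\<^esub> w}"

text \<open>With unit weights, the cost of a walk is its number of arcs.\<close>

definition graph_dist :: "('a, 'b) pre_digraph \<Rightarrow> 'a \<Rightarrow> 'a \<Rightarrow> ereal" where
  "graph_dist G u v = wf_digraph.\<mu> G (\<lambda>_. 1) u v"

definition is_shortest_path :: "('a, 'b) pre_digraph \<Rightarrow> 'a \<Rightarrow> 'b awalk \<Rightarrow> 'a \<Rightarrow> bool" where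
  "is_shortest_path G u p v \<longleftrightarrow>
     pre_digraph.apath G u p v \<and> ereal (real (length p)) = graph_dist G u v"

definition positionable :: "('a, 'b) pre_digraph \<Rightarrow> 'a set \<Rightarrow> 'a \<Rightarrow> 'a \<Rightarrow> bool" where
  "positionable G X u v \<longleftrightarrow>
     (\<forall>p. is_shortest_path G u p v \<longrightarrow> set (pre_digraph.awalk_verts G u p) \<inter> X \<subseteq> {u, v})"

definition outer_gp_set :: "('a, 'b) pre_digraph \<Rightarrow> 'a set \<Rightarrow> bool" where
  "outer_gp_set G X \<longleftrightarrow> X \<subseteq> verts G \<and>
     (\<forall>u \<in> X. \<forall>v \<in> X. positionable G X u v) \<and>
     (\<forall>u \<in> X. \<forall>v \<in> verts G - X. positionable G X u v)"

definition outer_gp_number :: "('a, 'b) pre_digraph \<Rightarrow> nat" where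
  "outer_gp_number G = Max (card ` {X. outer_gp_set G X})"

definition maximally_distant :: "('a, 'b) pre_digraph \<Rightarrow> 'a \<Rightarrow> 'a \<Rightarrow> bool" where
  "maximally_distant G u v \<longleftrightarrow> (\<forall>w \<in> nbhd G u. graph_dist G v w \<le> graph_dist G u v)"

definition mutually_maximally_distant :: "('a, 'b) pre_digraph \<Rightarrow> 'a \<Rightarrow> 'a \<Rightarrow> bool" where
  "mutually_maximally_distant G u v \<longleftrightarrow>
     u \<noteq> v \<and> maximally_distant G u v \<and> maximally_distant G v u"

definition strong_resolving_graph :: "('a, 'b) pre_digraph \<Rightarrow> 'a pair_pre_digraph" where
  "strong_resolving_graph G =
     \<lparr> pverts = verts G,
       parcs = {(u, v). u \<in> verts G \<and> v \<in> verts G \<and> mutually_maximally_distant G u v} \<rparr>"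

lemma pair_graph_strong_resolving_graph:
  assumes "graph G"
  shows "pair_graph (strong_resolving_graph G)"
proof -
  interpret graph G by (rule assms)
  have "{(u, v). u \<in> verts G \<and> v \<in> verts G \<and> mutually_maximally_distant G u v}
      \<subseteq> verts G \<times> verts G"
    by auto
  then have "finite {(u, v). u \<in> verts G \<and> v \<in> verts G \<and> mutually_maximally_distant G u v}"
    by (rule finite_subset) simp
  then show ?thesis
    by unfold_locales
      (auto simp: strong_resolving_graph_def mutually_maximally_distant_def symmetric_def sym_def)
qed

definition clique :: "('a, 'b) pre_digraph \<Rightarrow> 'a set \<Rightarrow> bool" where
  "clique G K \<longleftrightarrow> K \<subseteq> verts G \<and> (\<forall>u \<in> K. \<forall>v \<in> K. u \<noteq> v \<longrightarrow> u \<rightarrow>\<^bsub>G\<^esub> v)"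

definition clique_number :: "('a, 'b) pre_digraph \<Rightarrow> nat" where
  "clique_number G = Max (card ` {K. clique G K})"

end

theory Submission
  imports Defs
begin

text \<open>
  If \<open>u\<close> is not maximally distant from \<open>v\<close>, some neighbour \<open>w\<close> of \<open>u\<close> satisfies
  \<open>d v w = d v u + 1\<close>, so a shortest path from \<open>v\<close> to \<open>u\<close> followed by the edge \<open>u w\<close> is a
  shortest path with \<open>u\<close> in its interior; outer general position forbids this when \<open>u\<close> and \<open>v\<close>
  lie in \<open>X\<close>, whether or not \<open>w\<close> does. Conversely, if a shortest path from \<open>u \<in> X\<close> has \<open>x \<in> X\<close>
  in its interior, then the successor of \<open>x\<close> on it is farther from \<open>u\<close> than \<open>x\<close> is, so \<open>x\<close> is not
  maximally distant from \<open>u\<close>. The equivalence is trivially true for \<open>card X \<le> 1\<close> as well, so the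
  outer general position sets are exactly the cliques of the strong resolving graph.
\<close>

context wf_digraph
begin

lemma awalk_cost_unit: "awalk_cost (\<lambda>_. 1) p = real (length p)"
  by (induct p) auto

lemma graph_dist_le_length:
  assumes "awalk u p v"
  shows "graph_dist G u v \<le> ereal (real (length p))"
  using min_cost_le_walk_cost[OF assms, of "\<lambda>_. 1"]
  by (simp add: graph_dist_def awalk_cost_unit)

text \<open>Cutting a closed subwalk out of a walk with a repeated vertex would give a walk shorter
  than the distance. Concatenated walks are thus recognised as paths from their length
  alone.\<close>

lemma shortest_awalk_is_shortest_path:
  assumes p: "awalk u p v" and len: "ereal (real (length p)) \<le> graph_dist G u v"
  shows "is_shortest_path G u p v"
proof -
  have "distinct (awalk_verts u p)"
  proof (rule ccontr)
    assume "\<not> distinct (awalk_verts u p)"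
    then obtain q r s w where "p = q @ r @ s" "r \<noteq> []" "awalk u q w" "awalk w s v"
      using awalk_not_distinct_decomp[OF p] by blast
    then have "length (q @ s) < length p" and "awalk u (q @ s) v"
      using awalk_appendI by auto
    with graph_dist_le_length len show False
      by (meson ereal_less_eq(3) leD of_nat_le_iff order_trans)
  qed
  with p len graph_dist_le_length[OF p] show ?thesis
    by (simp add: is_shortest_path_def apath_def)
qed

lemma awalk_of_shortest_path: "is_shortest_path G u p v \<Longrightarrow> awalk u p v"
  by (simp add: is_shortest_path_def apath_def)

lemma length_shortest_path:
  "is_shortest_path G u p v \<Longrightarrow> graph_dist G u v = ereal (real (length p))"
  by (simp add: is_shortest_path_def)

end

lemma (in fin_digraph) shortest_path_exists:
  assumes "u \<rightarrow>\<^sup>* v"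
  obtains p where "is_shortest_path G u p v"
proof -
  obtain p where "apath u p v" "\<mu> (\<lambda>_. 1) u v = awalk_cost (\<lambda>_. 1) p"
    using min_cost_awalk[OF assms, of "\<lambda>_. 1"] by auto
  then have "is_shortest_path G u p v"
    by (simp add: is_shortest_path_def graph_dist_def awalk_cost_unit)
  then show thesis by (rule that)
qed

text \<open>A shorter walk to \<open>x\<close>, continued by \<open>q\<close>, would undercut the
  distance to \<open>v\<close>.\<close>

lemma (in fin_digraph) graph_dist_prefix:
  assumes "awalk u p x" "awalk x q v"
    and len: "graph_dist G u v = ereal (real (length (p @ q)))"
  shows "graph_dist G u x = ereal (real (length p))"
proof -
  obtain p' where p': "is_shortest_path G u p' x"
    using assms(1) by (meson reachable_awalkI shortest_path_exists)
  then have "awalk u (p' @ q) v"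
    using assms(2) awalk_appendI awalk_of_shortest_path by blast
  from graph_dist_le_length[OF this] len have "length p \<le> length p'" by simp
  with graph_dist_le_length[OF assms(1)] length_shortest_path[OF p'] show ?thesis by simp
qed

context sym_digraph
begin

text \<open>Arcs are abstract objects, so each one is replaced by some opposite arc that symmetry
  provides.\<close>

lemma awalk_reverse:
  assumes "awalk u p v"
  obtains q where "awalk v q u" "length q = length p"
proof -
  from assms have "\<exists>q. awalk v q u \<and> length q = length p"
  proof (induct p arbitrary: u)
    case Nil
    then show ?case by (auto simp: awalk_Nil_iff)
  next
    case (Cons e p)
    then obtain q where q: "awalk v q (head G e)" "length q = length p"
      by (auto simp: awalk_Cons_iff)
    from Cons.prems have e: "e \<in> arcs G" "tail G e = u" by (auto simp: awalk_Cons_iff)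
    then obtain e' where "e' \<in> arcs G" "tail G e' = head G e" "head G e' = u"
      using sym_arcs unfolding symmetric_conv by metis
    then have "awalk (head G e) [e'] u" using arc_implies_awalk by metis
    with q show ?case by (intro exI[of _ "q @ [e']"]) (auto intro: awalk_appendI)
  qed
  then show thesis using that by blast
qed

lemma graph_dist_le_swap: "graph_dist G u v \<le> graph_dist G v u"
proof -
  have "graph_dist G u v \<le> ereal (real (length p))" if "awalk v p u" for p
    using that by (metis awalk_reverse graph_dist_le_length)
  then show ?thesis
    unfolding graph_dist_def \<mu>_def awalk_cost_unit
    by (auto intro: INF_greatest)
qed

lemma graph_dist_commute: "graph_dist G u v = graph_dist G v u"
  by (intro antisym graph_dist_le_swap)

end

text \<open>The endpoint \<open>v\<close> is arbitrary, so this serves both clauses of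
  \<open>outer_gp_set\<close>.\<close>

lemma (in pseudo_graph) positionable_if_maximally_distant:
  assumes far: "\<And>x. x \<in> X \<Longrightarrow> x \<noteq> u \<Longrightarrow> maximally_distant G x u"
  shows "positionable G X u v"
  unfolding positionable_def
proof (intro allI impI subsetI)
  fix p x
  assume p: "is_shortest_path G u p v" and x: "x \<in> set (awalk_verts u p) \<inter> X"
  show "x \<in> {u, v}"
  proof (rule ccontr)
    assume "x \<notin> {u, v}"
    obtain q r where pqr: "p = q @ r" and q: "awalk u q x" and r: "awalk x r v"
      using awalk_decomp[OF awalk_of_shortest_path[OF p]] x by blast
    with \<open>x \<notin> {u, v}\<close> obtain e s where res: "r = e # s"
      by (cases r) (auto simp: awalk_Nil_iff)
    let ?w = "head G e"
    from r have e: "e \<in> arcs G" "tail G e = x" and s: "awalk ?w s v"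
      by (auto simp: res awalk_Cons_iff)
    then have "awalk x [e] ?w" using arc_implies_awalk by metis
    with q have qe: "awalk u (q @ [e]) ?w" by (rule awalk_appendI)
    note len = length_shortest_path[OF p]
    \<comment> \<open>Both prefixes of the shortest path are themselves shortest, so the step from
      \<open>x\<close> to \<open>?w\<close> raises the distance from \<open>u\<close> by
      one.\<close>
    have "graph_dist G u x = ereal (real (length q))"
      using graph_dist_prefix[OF q r] len pqr by simp
    moreover have "graph_dist G u ?w = ereal (real (length (q @ [e])))"
      using graph_dist_prefix[OF qe s] len by (simp add: pqr res)
    moreover have "?w \<in> nbhd G x"
      using in_arcs_imp_in_arcs_ends[OF e(1)] e(2) by (simp add: nbhd_def)
    ultimately show False
      using far[of x] x \<open>x \<notin> {u, v}\<close>
      by (auto simp: maximally_distant_def graph_dist_commute[of x u])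
  qed
qed

lemma (in graph) maximally_distant_if_positionable:
  assumes reach: "v \<rightarrow>\<^sup>* u" and "u \<in> X" "u \<noteq> v"
    and pos: "\<And>w. w \<in> verts G \<Longrightarrow> positionable G X v w"
  shows "maximally_distant G u v"
  unfolding maximally_distant_def
proof (intro ballI, rule ccontr)
  fix w
  assume "w \<in> nbhd G u" and far: "\<not> graph_dist G v w \<le> graph_dist G u v"
  then obtain e where e: "e \<in> arcs G" "tail G e = u" "head G e = w"
    by (auto simp: nbhd_def arcs_ends_conv)
  obtain p where p: "is_shortest_path G v p u"
    using reach by (rule shortest_path_exists)
  have walk: "awalk v (p @ [e]) w"
    using awalk_of_shortest_path[OF p] e arc_implies_awalk awalk_appendI by metis
  have "graph_dist G u v = ereal (real (length p))"
    using p by (simp add: graph_dist_commute[of u v] length_shortest_path)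
  have "w \<in> verts G" using e by auto
  \<comment> \<open>The path \<open>q\<close> shows that the distance to \<open>w\<close> is a
    natural number, so being larger than \<open>length p\<close> means being at least
    \<open>length p + 1\<close>.\<close>
  then obtain q where q: "is_shortest_path G v q w"
    using walk by (meson reachable_awalkI shortest_path_exists)
  with far p have "length p < length q"
    by (simp add: graph_dist_commute[of u v] length_shortest_path)
  then have "ereal (real (length (p @ [e]))) \<le> graph_dist G v w"
    using q by (simp add: length_shortest_path)
  with walk have "is_shortest_path G v (p @ [e]) w"
    by (rule shortest_awalk_is_shortest_path)
  moreover have "u \<in> set (awalk_verts v (p @ [e]))"
    using e by (auto intro: awalk_verts_arc1)
  \<comment> \<open>Positionability forces \<open>u\<close> to be an endpoint, but \<open>u\<close>
    differs from \<open>v\<close>, and \<open>u = w\<close> would be a loop.\<close>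
  ultimately have "u \<in> {v, w}"
    using pos[OF \<open>w \<in> verts G\<close>] \<open>u \<in> X\<close> unfolding positionable_def by blast
  with \<open>u \<noteq> v\<close> have "u = w" by simp
  with \<open>w \<in> nbhd G u\<close> show False using adj_not_same by (simp add: nbhd_def)
qed

lemma (in graph) outer_gp_set_iff:
  assumes "connected G" "X \<subseteq> verts G"
  shows "outer_gp_set G X \<longleftrightarrow>
    (\<forall>u \<in> X. \<forall>v \<in> X. u \<noteq> v \<longrightarrow> mutually_maximally_distant G u v)"
proof
  assume X: "outer_gp_set G X"
  have "maximally_distant G u v" if "u \<in> X" "v \<in> X" "u \<noteq> v" for u v
  proof (rule maximally_distant_if_positionable)
    show "v \<rightarrow>\<^sup>* u"
      using symmetric_connected_imp_strongly_connected[OF sym_arcs assms(1)] that assms(2)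
      by auto
    show "positionable G X v w" if "w \<in> verts G" for w
      using X \<open>v \<in> X\<close> that unfolding outer_gp_set_def by blast
  qed (use that in auto)
  then show "\<forall>u \<in> X. \<forall>v \<in> X. u \<noteq> v \<longrightarrow> mutually_maximally_distant G u v"
    by (simp add: mutually_maximally_distant_def)
next
  assume "\<forall>u \<in> X. \<forall>v \<in> X. u \<noteq> v \<longrightarrow> mutually_maximally_distant G u v"
  then have "positionable G X u v" if "u \<in> X" for u v
    using that by (intro positionable_if_maximally_distant) (auto simp: mutually_maximally_distant_def)
  then show "outer_gp_set G X" using assms(2) by (simp add: outer_gp_set_def)
qed

lemma clique_strong_resolving_graph_iff:
  "clique (with_proj (strong_resolving_graph G)) X \<longleftrightarrow> X \<subseteq> verts G \<and>
    (\<forall>u \<in> X. \<forall>v \<in> X. u \<noteq> v \<longrightarrow> mutually_maximally_distant G u v)"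
  by (auto simp: clique_def strong_resolving_graph_def)

theorem theorem2p3:
  fixes G :: "('a, 'b) pre_digraph"
  assumes "graph G" and "connected G"
  shows "(\<forall>X. X \<subseteq> verts G \<and> card X \<ge> 2 \<longrightarrow>
            (outer_gp_set G X \<longleftrightarrow>
              (\<forall>u \<in> X. \<forall>v \<in> X. u \<noteq> v \<longrightarrow> mutually_maximally_distant G u v)))
         \<and> outer_gp_number G = clique_number (with_proj (strong_resolving_graph G))"
proof -
  interpret graph G by (rule assms(1))
  \<comment> \<open>This covers sets of every size, so the two maxima range over the same
    family.\<close>
  have "outer_gp_set G X \<longleftrightarrow> clique (with_proj (strong_resolving_graph G)) X" for X
    using outer_gp_set_iff[OF assms(2), of X]
    by (auto simp: clique_strong_resolving_graph_iff outer_gp_set_def)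
  then show ?thesis
    using outer_gp_set_iff[OF assms(2)]
    by (simp add: outer_gp_number_def clique_number_def)
qed

end
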